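(* There exists a topologically C*-transitive operator on $\tilde\ell_2(B_0(H))$ which is not generalized numerically transitive.
   Context: $H$ is a complex separable Hilbert space with an orthonormal basis $\{e_j\}_{j\in\mathbb Z}$, and $B_0(H)$ is the C*-algebra of compact operators on $H$ with the operator norm. $\tilde\ell_2(B_0(H))$ is the standard Hilbert module over $B_0(H)$: the space of sequences $x=(x_j)_{j\in\mathbb N}$ in $B_0(H)$ for which $\sum_j x_j^*x_j$ converges in norm, with $B_0(H)$-valued inner product $\varphi(x,y)=\langle y,x\rangle=\sum_{j=1}^\infty y_j^*x_j$ and norm $\|x\|=\|\varphi(x,x)\|^{1/2}$. It is a Banach algebra under componentwise multiplication $(xy)_j=x_jy_j$. Operators are bounded linear maps. Write $X=\tilde\ell_2(B_0(H))$ and $S(X)$ for its unit sphere. $T\in\mathcal B(X)$ is topologically C*-transitive (with respect to $\varphi$) if for every nonempty open $W\subseteq S(X)\times S(X)$ and nonempty open $O\subseteq B_0(H)$ there exist $n\in\mathbb N$ and $(x,y)\in W$ with $\varphi(T^nx,y)\in O$. $T$ is generalized numerically transitive if for every nonempty open $\widetilde O\subseteq X\times X$ and nonempty open $O\subseteq X$ there exist $n\in\mathbb N$ and $(x,y)\in\widetilde O$ with $x\,T^n(y)\in O$ (componentwise product). *)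

theory Defs
  imports "HOL-Analysis.Analysis"
begin

section \<open>Complex Hilbert spaces\<close>

text \<open>The norm, distance and topology come from the real inner product, which is the real part
  of the complex one. The complex inner product is linear in its first argument.\<close>

class complex_hilbert_space = real_inner + complete_space +
  fixes scaleC :: "complex \<Rightarrow> 'a \<Rightarrow> 'a"  (infixr "*\<^sub>C" 75)
    and cinner :: "'a \<Rightarrow> 'a \<Rightarrow> complex"
  assumes scaleC_add_right: "c *\<^sub>C (x + y) = c *\<^sub>C x + c *\<^sub>C y"
    and scaleC_add_left: "(c + d) *\<^sub>C x = c *\<^sub>C x + d *\<^sub>C x"
    and scaleC_scaleC: "c *\<^sub>C d *\<^sub>C x = (c * d) *\<^sub>C x"
    and scaleC_of_real: "complex_of_real r *\<^sub>C x = r *\<^sub>R x"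
    and cinner_commute: "cinner x y = cnj (cinner y x)"
    and cinner_add_left: "cinner (x + y) z = cinner x z + cinner y z"
    and cinner_scaleC_left: "cinner (c *\<^sub>C x) y = c * cinner x y"
    and inner_eq_Re_cinner: "inner x y = Re (cinner x y)"

definition orthonormal_basis :: "('i \<Rightarrow> 'h::complex_hilbert_space) \<Rightarrow> bool" where
  "orthonormal_basis e \<longleftrightarrow>
     (\<forall>i j. cinner (e i) (e j) = (if i = j then 1 else 0)) \<and>
     closure {\<Sum>i\<in>F. c i *\<^sub>C e i | F c. finite F} = UNIV"


section \<open>Compact operators\<close>

text \<open>The type \<open>'h \<Rightarrow>\<^sub>L 'h\<close> consists of the bounded real-linear maps, so complex
  linearity is a separate requirement.\<close>

definition compact_operators :: "('h::complex_hilbert_space \<Rightarrow>\<^sub>L 'h) set" where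
  "compact_operators =
     {A. (\<forall>c u. blinfun_apply A (c *\<^sub>C u) = c *\<^sub>C blinfun_apply A u) \<and> compact (closure (blinfun_apply A ` cball 0 1))}"

definition op_adjoint ::
    "('h::complex_hilbert_space \<Rightarrow>\<^sub>L 'h) \<Rightarrow> ('h \<Rightarrow>\<^sub>L 'h)" where
  "op_adjoint A = (THE B. \<forall>u v. cinner (blinfun_apply A u) v = cinner u (blinfun_apply B v))"

lemma norm_scaleC: "norm (c *\<^sub>C x) = cmod c * norm (x::'h::complex_hilbert_space)"
proof -
  have c: "cinner y (c *\<^sub>C z) = cnj c * cinner y z" for y z :: 'h
    by (metis cinner_commute cinner_scaleC_left complex_cnj_mult)
  have "cinner (c *\<^sub>C x) (c *\<^sub>C x) = complex_of_real ((cmod c)\<^sup>2) * cinner x x"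
    by (simp only: c cinner_scaleC_left complex_norm_square mult_ac)
  hence "inner (c *\<^sub>C x) (c *\<^sub>C x) = (cmod c)\<^sup>2 * inner x x"
    by (simp add: inner_eq_Re_cinner)
  hence "(norm (c *\<^sub>C x))\<^sup>2 = (cmod c * norm x)\<^sup>2"
    by (simp add: power2_norm_eq_inner power_mult_distrib)
  thus ?thesis by (simp add: power2_eq_iff_nonneg)
qed

lemma bounded_linear_scaleC: "bounded_linear (\<lambda>x::'h::complex_hilbert_space. c *\<^sub>C x)"
proof (rule bounded_linear_intro[where K = "cmod c"])
  fix r and x :: 'h
  show "c *\<^sub>C r *\<^sub>R x = r *\<^sub>R c *\<^sub>C x"
    by (metis scaleC_of_real scaleC_scaleC mult.commute)
qed (simp_all add: scaleC_add_right norm_scaleC mult.commute)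

lift_definition op_scaleC ::
    "complex \<Rightarrow> ('h::complex_hilbert_space \<Rightarrow>\<^sub>L 'h) \<Rightarrow> ('h \<Rightarrow>\<^sub>L 'h)"
  is "\<lambda>c (A :: 'h \<Rightarrow> 'h) u. c *\<^sub>C A u"
  using bounded_linear_compose[OF bounded_linear_scaleC] by blast


section \<open>The standard Hilbert module over the compact operators\<close>

text \<open>Sequences are indexed from 0, i.e. the entry \<open>x j\<close> is the mathematical \<open>x\<^sub>j\<^sub>+\<^sub>1\<close>.\<close>

type_synonym 'h op_seq = "nat \<Rightarrow> 'h \<Rightarrow>\<^sub>L 'h"

definition std_module :: "'h::complex_hilbert_space op_seq set" where
  "std_module =
     {x. (\<forall>j. x j \<in> compact_operators) \<and> summable (\<lambda>j. op_adjoint (x j) o\<^sub>L x j)}"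

definition mod_form ::
    "'h::complex_hilbert_space op_seq \<Rightarrow> 'h op_seq \<Rightarrow> ('h \<Rightarrow>\<^sub>L 'h)" where
  "mod_form x y = (\<Sum>j. op_adjoint (y j) o\<^sub>L x j)"

definition mod_norm :: "'h::complex_hilbert_space op_seq \<Rightarrow> real" where
  "mod_norm x = sqrt (norm (mod_form x x))"

definition mod_sphere :: "'h::complex_hilbert_space op_seq set" where
  "mod_sphere = {x \<in> std_module. mod_norm x = 1}"

definition mod_topology :: "'h::complex_hilbert_space op_seq topology" where
  "mod_topology = topology (\<lambda>U. U \<subseteq> std_module \<and>
     (\<forall>x\<in>U. \<exists>r>0. \<forall>y\<in>std_module. mod_norm (\<lambda>j. y j - x j) < r \<longrightarrow> y \<in> U))"

lemma openin_mod_topology: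
  "openin mod_topology U \<longleftrightarrow> U \<subseteq> std_module \<and>
     (\<forall>x\<in>U. \<exists>r>0. \<forall>y\<in>std_module. mod_norm (\<lambda>j. y j - x j) < r \<longrightarrow> y \<in> U)"
proof -
  have "istopology (\<lambda>U. U \<subseteq> std_module \<and>
     (\<forall>x\<in>U. \<exists>r>0. \<forall>y\<in>std_module. mod_norm (\<lambda>j. y j - x j) < r \<longrightarrow> y \<in> U))"
    (is "istopology ?P")
    unfolding istopology_def
  proof (intro conjI allI impI)
    fix S T assume S: "?P S" and T: "?P T"
    show "S \<inter> T \<subseteq> std_module" using S by blast
    show "\<forall>x\<in>S \<inter> T. \<exists>r>0. \<forall>y\<in>std_module. mod_norm (\<lambda>j. y j - x j) < r \<longrightarrow> y \<in> S \<inter> T"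
    proof
      fix x assume x: "x \<in> S \<inter> T"
      obtain r where r: "r > 0" "\<forall>y\<in>std_module. mod_norm (\<lambda>j. y j - x j) < r \<longrightarrow> y \<in> S"
        using S x by blast
      obtain s where s: "s > 0" "\<forall>y\<in>std_module. mod_norm (\<lambda>j. y j - x j) < s \<longrightarrow> y \<in> T"
        using T x by blast
      show "\<exists>r>0. \<forall>y\<in>std_module. mod_norm (\<lambda>j. y j - x j) < r \<longrightarrow> y \<in> S \<inter> T"
        using r s by (intro exI[of _ "min r s"]) auto
    qed
  next
    fix K assume K: "\<forall>S\<in>K. ?P S"
    show "\<Union>K \<subseteq> std_module" using K by blast
    show "\<forall>x\<in>\<Union>K. \<exists>r>0. \<forall>y\<in>std_module. mod_norm (\<lambda>j. y j - x j) < r \<longrightarrow> y \<in> \<Union>K"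
      using K by (meson UnionE UnionI)
  qed
  thus ?thesis unfolding mod_topology_def by (subst topology_inverse') (assumption, rule refl)
qed

definition bounded_operator ::
    "('h::complex_hilbert_space op_seq \<Rightarrow> 'h op_seq) \<Rightarrow> bool" where
  "bounded_operator T \<longleftrightarrow>
     (\<forall>x\<in>std_module. T x \<in> std_module) \<and>
     (\<forall>x\<in>std_module. \<forall>y\<in>std_module. T (\<lambda>j. x j + y j) = (\<lambda>j. T x j + T y j)) \<and>
     (\<forall>c. \<forall>x\<in>std_module. T (\<lambda>j. op_scaleC c (x j)) = (\<lambda>j. op_scaleC c (T x j))) \<and>
     (\<exists>K. \<forall>x\<in>std_module. mod_norm (T x) \<le> K * mod_norm x)"


section \<open>Transitivity\<close>

text \<open>The exponents \<open>n\<close> below range over the positive integers.\<close>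

definition topologically_Cstar_transitive ::
    "('h::complex_hilbert_space op_seq \<Rightarrow> 'h op_seq) \<Rightarrow> bool" where
  "topologically_Cstar_transitive T \<longleftrightarrow>
     (\<forall>W V. openin (subtopology (prod_topology mod_topology mod_topology)
                 (mod_sphere \<times> mod_sphere)) W \<and> W \<noteq> {} \<and>
            openin (top_of_set compact_operators) V \<and> V \<noteq> {} \<longrightarrow>
        (\<exists>n\<ge>1. \<exists>(x, y)\<in>W. mod_form ((T ^^ n) x) y \<in> V))"

definition generalized_numerically_transitive ::
    "('h::complex_hilbert_space op_seq \<Rightarrow> 'h op_seq) \<Rightarrow> bool" where
  "generalized_numerically_transitive T \<longleftrightarrow>
     (\<forall>W V. openin (prod_topology mod_topology mod_topology) W \<and> W \<noteq> {} \<and>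
            openin mod_topology V \<and> V \<noteq> {} \<longrightarrow>
        (\<exists>n\<ge>1. \<exists>(x, y)\<in>W. (\<lambda>j. x j o\<^sub>L (T ^^ n) y j) \<in> V))"

end

theory Submission imports Defs begin

text \<open>The operator is twice the forward shift. Every iterate of it has zero first entry, so no
  product \<open>x T\<^sup>n(y)\<close> meets the open set of sequences with nonzero first entry. For transitivity,
  given unit vectors \<open>x\<close>, \<open>y\<close> and a compact operator \<open>A\<close>, cut off \<open>x\<close> and \<open>y\<close> at a large index \<open>m\<close>,
  put \<open>\<delta>\<^sup>-\<^sup>1 2\<^sup>-\<^sup>n A\<close> at position \<open>m\<close> of \<open>x\<close> and \<open>\<delta> P\<close> at position \<open>n + m\<close> of \<open>y\<close>, where \<open>P\<close> is a
  finite-rank projection with \<open>P A\<close> close to \<open>A\<close>. For \<open>n \<ge> m\<close> these two entries alone meet under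
  the form, which equals \<open>P A\<close>; for small \<open>\<delta>\<close> and large \<open>n\<close> the perturbation is small, and
  normalising the two vectors changes the value only slightly.\<close>

section \<open>Adjoints\<close>

text \<open>This makes the bounded operators a Banach space, so series of operators can be tested by
  the Cauchy criterion.\<close>

instance complex_hilbert_space \<subseteq> banach ..

text \<open>If \<open>f\<close> is the inner product with \<open>w\<close>, then \<open>J u\<close>
  is the squared distance from \<open>u\<close> to \<open>w\<close> minus the squared norm of
  \<open>w\<close>. So the representing vector is found as a minimiser of \<open>J\<close>, which
  exists by completeness.\<close>

lemma riesz_representation:
  fixes f :: "'a::{real_inner, complete_space} \<Rightarrow> real"
  assumes "bounded_linear f"
  shows "\<exists>w. \<forall>u. f u = inner u w"
proof -
  interpret f: bounded_linear f by fact
  obtain K where K: "\<And>u. norm (f u) \<le> norm u * K"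
    using f.bounded by blast
  define J where "J u = inner u u - 2 * f u" for u
  have J_lower: "J u \<ge> - K\<^sup>2" for u
  proof -
    have "f u \<le> norm u * K" using K[of u] by simp
    then have "J u \<ge> (norm u)\<^sup>2 - 2 * (norm u * K)"
      by (simp add: J_def power2_norm_eq_inner)
    moreover have "(norm u - K)\<^sup>2 \<ge> 0" by simp
    ultimately show ?thesis by (simp add: power2_diff)
  qed
  define m where "m = Inf (range J)"
  have bdd: "bdd_below (range J)"
    using J_lower by (auto intro!: bdd_belowI)
  have m_le: "m \<le> J u" for u
    unfolding m_def by (rule cInf_lower[OF _ bdd]) simp
  have "\<exists>u. J u < m + inverse (real (Suc n))" for n
    using cInf_less_iff[OF _ bdd, of "m + inverse (real (Suc n))"]
    by (auto simp: m_def)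
  then obtain s where s: "\<And>n. J (s n) < m + inverse (real (Suc n))"
    by metis
  \<comment> \<open>Parallelogram law at the midpoint: the linear part of \<open>J\<close> cancels,
    and \<open>J\<close> at the midpoint is at least \<open>m\<close>. Hence minimising sequences
    are Cauchy.\<close>
  have parallelogram: "(dist u v)\<^sup>2 \<le> 2 * (J u - m) + 2 * (J v - m)" for u v
  proof -
    have "(dist u v)\<^sup>2 = 2 * J u + 2 * J v - 4 * J ((1/2) *\<^sub>R (u + v))"
      by (simp add: J_def dist_norm power2_norm_eq_inner f.scaleR f.add inner_commute
          algebra_simps)
    with m_le[of "(1/2) *\<^sub>R (u + v)"] show ?thesis by simp
  qed
  have "Cauchy s"
  proof (rule metric_CauchyI)
    fix \<epsilon> :: real assume "\<epsilon> > 0"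
    then obtain N where N: "inverse (real (Suc N)) < \<epsilon>\<^sup>2 / 4"
      using reals_Archimedean[of "\<epsilon>\<^sup>2 / 4"] by auto
    have "dist (s i) (s j) < \<epsilon>" if "i \<ge> N" "j \<ge> N" for i j
    proof -
      have close: "J (s k) - m < \<epsilon>\<^sup>2 / 4" if "k \<ge> N" for k
      proof -
        have "inverse (real (Suc k)) \<le> inverse (real (Suc N))"
          using that by (intro le_imp_inverse_le) auto
        with s[of k] N show ?thesis by argo
      qed
      have "(dist (s i) (s j))\<^sup>2 < \<epsilon>\<^sup>2"
        using parallelogram[of "s i" "s j"] close[OF that(1)] close[OF that(2)] by argo
      then show ?thesis using \<open>\<epsilon> > 0\<close> by (simp add: power2_less_imp_less)
    qed
    then show "\<exists>N. \<forall>i\<ge>N. \<forall>j\<ge>N. dist (s i) (s j) < \<epsilon>" by blast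
  qed
  then obtain w where w: "s \<longlonglongrightarrow> w"
    by (auto dest!: Cauchy_convergent simp: convergent_def)
  have "(\<lambda>n. J (s n)) \<longlonglongrightarrow> J w"
    unfolding J_def by (intro tendsto_intros w f.tendsto)
  moreover have "(\<lambda>n. m + inverse (real (Suc n))) \<longlonglongrightarrow> m + 0"
    by (intro tendsto_intros LIMSEQ_inverse_real_of_nat)
  ultimately have "J w \<le> m + 0"
    by (rule LIMSEQ_le) (use less_imp_le[OF s] in blast)
  then have min: "J w \<le> J u" for u using m_le[of u] by simp
  have "f u = inner u w" for u
  proof (cases "u = 0")
    case True then show ?thesis by (simp add: f.zero)
  next
    case False
    \<comment> \<open>This \<open>t\<close> minimises \<open>J\<close> on the line through
      \<open>w\<close> in direction \<open>u\<close>. There \<open>J\<close> falls below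
      \<open>J w\<close> by \<open>t\<^sup>2 * inner u u\<close>, which forces
      \<open>t = 0\<close>.\<close>
    define t where "t = (f u - inner u w) / inner u u"
    have pos: "inner u u > 0" using False by simp
    have "J (w + t *\<^sub>R u) = J w - 2 * t * (f u - inner u w) + t\<^sup>2 * inner u u"
      by (simp add: J_def f.add f.scaleR algebra_simps inner_commute power2_eq_square)
    moreover have "t * (f u - inner u w) = t\<^sup>2 * inner u u"
      using pos by (simp add: t_def power2_eq_square)
    ultimately have "t\<^sup>2 * inner u u \<le> 0" using min[of "w + t *\<^sub>R u"] by simp
    then have "t = 0" using pos by (simp add: mult_le_0_iff)
    then show ?thesis using pos by (simp add: t_def)
  qed
  then show ?thesis by blast
qed

lemma scaleC_zero_right [simp]: "c *\<^sub>C (0::'h::complex_hilbert_space) = 0"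
  using norm_scaleC[of c "0::'h"] by simp

definition complex_linear :: "('h::complex_hilbert_space \<Rightarrow>\<^sub>L 'h) \<Rightarrow> bool" where
  "complex_linear A \<longleftrightarrow> (\<forall>c u. blinfun_apply A (c *\<^sub>C u) = c *\<^sub>C blinfun_apply A u)"

text \<open>Riesz representation gives \<open>b v\<close> for each \<open>v\<close> separately;
  linearity of \<open>b\<close> follows because a vector is determined by its inner
  products.\<close>

lemma real_adjoint_exists:
  fixes A :: "'h::complex_hilbert_space \<Rightarrow>\<^sub>L 'h"
  shows "\<exists>B. \<forall>u v. inner (blinfun_apply A u) v = inner u (blinfun_apply B v)"
proof -
  have "\<exists>w. \<forall>u. inner (blinfun_apply A u) v = inner u w" for v
    by (intro riesz_representation bounded_linear_compose[OF bounded_linear_inner_left]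
        blinfun.bounded_linear_right)
  then obtain b where b: "\<And>u v. inner (blinfun_apply A u) v = inner u (b v)"
    by metis
  have "bounded_linear b"
  proof (rule bounded_linear_intro)
    show "b (v + w) = b v + b w" for v w
      by (rule vector_eq_ldot[THEN iffD1]) (simp add: b[symmetric] inner_add_right)
    show "b (r *\<^sub>R v) = r *\<^sub>R b v" for r v
      by (rule vector_eq_ldot[THEN iffD1]) (simp add: b[symmetric])
    show "norm (b v) \<le> norm v * norm A" for v
    proof (cases "b v = 0")
      case False
      \<comment> \<open>Testing the adjoint identity at \<open>u = b v\<close> bounds the squared
        norm of \<open>b v\<close>; one factor is then cancelled.\<close>
      have "norm (b v) * norm (b v) = inner (blinfun_apply A (b v)) v"
        by (simp add: b flip: power2_norm_eq_inner power2_eq_square)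
      also have "\<dots> \<le> norm (blinfun_apply A (b v)) * norm v" by (rule norm_cauchy_schwarz)
      also have "\<dots> \<le> norm A * norm (b v) * norm v"
        by (intro mult_right_mono norm_blinfun norm_ge_zero)
      finally have "norm (b v) * norm (b v) \<le> norm (b v) * (norm v * norm A)"
        by (simp add: mult_ac)
      then show ?thesis using False by simp
    qed simp
  qed
  then show ?thesis
    using b by (intro exI[of _ "Blinfun b"]) (simp add: bounded_linear_Blinfun_apply)
qed

lemma cinner_scaleC_right: "cinner x (c *\<^sub>C y) = cnj c * cinner x (y::'h::complex_hilbert_space)"
  by (metis cinner_commute cinner_scaleC_left complex_cnj_mult)

text \<open>Reduces complex identities to real ones: the imaginary part is a real inner product at a
  rotated vector.\<close>

lemma Im_cinner: "Im (cinner x y) = inner ((- \<i>) *\<^sub>C x) (y::'h::complex_hilbert_space)"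
  by (simp add: inner_eq_Re_cinner cinner_scaleC_left)

text \<open>The real identity gives the real part of the complex one. Applied to
  \<open>(- \<i>) *\<^sub>C u\<close>, with complex linearity of \<open>A\<close>, it gives the
  imaginary part.\<close>

lemma op_adjoint_eqI:
  fixes A B :: "'h::complex_hilbert_space \<Rightarrow>\<^sub>L 'h"
  assumes "complex_linear A"
    and AB: "\<And>u v. inner (blinfun_apply A u) v = inner u (blinfun_apply B v)"
  shows "op_adjoint A = B"
  unfolding op_adjoint_def
proof (rule the_equality)
  show "\<forall>u v. cinner (blinfun_apply A u) v = cinner u (blinfun_apply B v)"
    using assms(1) AB
    by (simp add: complex_eq_iff Im_cinner complex_linear_def flip: inner_eq_Re_cinner)
      (metis complex_linear_def)
next
  fix C assume C: "\<forall>u v. cinner (blinfun_apply A u) v = cinner u (blinfun_apply C v)"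
  show "C = B"
  proof (rule blinfun_eqI)
    show "blinfun_apply C v = blinfun_apply B v" for v
      by (rule vector_eq_ldot[THEN iffD1]) (metis AB C inner_eq_Re_cinner)
  qed
qed

lemma inner_op_adjoint:
  fixes A :: "'h::complex_hilbert_space \<Rightarrow>\<^sub>L 'h"
  assumes "complex_linear A"
  shows "inner u (blinfun_apply (op_adjoint A) v) = inner (blinfun_apply A u) v"
proof -
  obtain B where B: "\<And>u v. inner (blinfun_apply A u) v = inner u (blinfun_apply B v)"
    using real_adjoint_exists[of A] by blast
  show ?thesis using op_adjoint_eqI[OF assms B] B by simp
qed

lemma op_adjoint_scaleR:
  assumes "complex_linear (A :: 'h::complex_hilbert_space \<Rightarrow>\<^sub>L 'h)"
  shows "op_adjoint (r *\<^sub>R A) = r *\<^sub>R op_adjoint A"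
proof (rule op_adjoint_eqI)
  show "complex_linear (r *\<^sub>R A)"
    using assms unfolding complex_linear_def
    by (simp add: blinfun.scaleR_left scaleC_scaleC mult.commute flip: scaleC_of_real)
qed (simp add: blinfun.scaleR_left inner_op_adjoint[OF assms])

lemma op_adjoint_zero [simp]: "op_adjoint (0 :: 'h::complex_hilbert_space \<Rightarrow>\<^sub>L 'h) = 0"
  by (rule op_adjoint_eqI) (simp_all add: complex_linear_def)

section \<open>Compact operators and finite-rank projections\<close>

text \<open>Containment in some compact set passes to sums and compositions more easily than
  compactness of a closure.\<close>

lemma compact_operators_iff:
  "A \<in> compact_operators \<longleftrightarrow>
     complex_linear A \<and> (\<exists>K. compact K \<and> blinfun_apply A ` cball 0 1 \<subseteq> K)"
proof -
  let ?S = "blinfun_apply A ` cball 0 1"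
  have "compact (closure ?S)" if "compact K" "?S \<subseteq> K" for K
    using compact_Int_closed[OF that(1) closed_closure[of ?S]]
      closure_minimal[OF that(2) compact_imp_closed[OF that(1)]] by (simp add: inf_absorb2)
  moreover have "?S \<subseteq> closure ?S" by (rule closure_subset)
  ultimately have "compact (closure ?S) \<longleftrightarrow> (\<exists>K. compact K \<and> ?S \<subseteq> K)" by metis
  then show ?thesis
    by (simp add: compact_operators_def complex_linear_def)
qed

lemma compact_operators_complex_linear: "A \<in> compact_operators \<Longrightarrow> complex_linear A"
  by (simp add: compact_operators_iff)

lemma compact_operators_compose:
  assumes "A \<in> compact_operators" and "complex_linear B"
  shows "B o\<^sub>L A \<in> compact_operators"
proof -
  obtain K where K: "compact K" "blinfun_apply A ` cball 0 1 \<subseteq> K"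
    using assms by (auto simp: compact_operators_iff)
  have "compact (blinfun_apply B ` K)"
    by (intro compact_continuous_image K linear_continuous_on blinfun.bounded_linear_right)
  moreover have "blinfun_apply (B o\<^sub>L A) ` cball 0 1 \<subseteq> blinfun_apply B ` K"
    using K by auto
  moreover have "complex_linear (B o\<^sub>L A)"
    using assms by (simp add: complex_linear_def compact_operators_iff)
  ultimately show ?thesis unfolding compact_operators_iff by blast
qed

lemma compact_operators_add:
  assumes "A \<in> compact_operators" "B \<in> compact_operators"
  shows "A + B \<in> compact_operators"
proof -
  obtain K L where K: "compact K" "blinfun_apply A ` cball 0 1 \<subseteq> K"
    and L: "compact L" "blinfun_apply B ` cball 0 1 \<subseteq> L"
    using assms by (auto simp: compact_operators_iff)
  have "compact {x + y | x y. x \<in> K \<and> y \<in> L}"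
    by (intro compact_sums K L)
  moreover have "blinfun_apply (A + B) ` cball 0 1 \<subseteq> {x + y | x y. x \<in> K \<and> y \<in> L}"
    using K L by (force simp: blinfun.add_left)
  moreover have "complex_linear (A + B)"
    using assms by (simp add: complex_linear_def compact_operators_iff blinfun.add_left scaleC_add_right)
  ultimately show ?thesis unfolding compact_operators_iff by blast
qed

lemma complex_linear_scaleR_id: "complex_linear (r *\<^sub>R (id_blinfun :: 'h::complex_hilbert_space \<Rightarrow>\<^sub>L 'h))"
  by (simp add: complex_linear_def blinfun.scaleR_left scaleC_scaleC mult.commute flip: scaleC_of_real)

lemma compact_operators_scaleR:
  assumes "A \<in> compact_operators"
  shows "r *\<^sub>R A \<in> compact_operators"
proof -
  have "r *\<^sub>R A = r *\<^sub>R id_blinfun o\<^sub>L A"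
    by (rule blinfun_eqI) (simp add: blinfun.scaleR_left)
  then show ?thesis
    using compact_operators_compose[OF assms complex_linear_scaleR_id] by simp
qed

lemma zero_in_compact_operators:
  "(0 :: 'h::complex_hilbert_space \<Rightarrow>\<^sub>L 'h) \<in> compact_operators"
proof -
  have "blinfun_apply (0 :: 'h \<Rightarrow>\<^sub>L 'h) ` cball 0 1 \<subseteq> {0}" by auto
  then show ?thesis
    unfolding compact_operators_iff complex_linear_def by (auto intro!: exI[of _ "{0}"])
qed

section \<open>Rank-one operators and projections onto spans of basis vectors\<close>

lemma scaleC_zero_left [simp]: "0 *\<^sub>C (u::'h::complex_hilbert_space) = 0"
  using norm_scaleC[of 0 u] by simp

lemma bounded_linear_cinner_left: "bounded_linear (\<lambda>u. cinner u (v::'h::complex_hilbert_space))"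
proof -
  have "cinner u v = Complex (inner u v) (inner ((- \<i>) *\<^sub>C u) v)" for u
    by (simp add: complex_eq_iff Im_cinner inner_eq_Re_cinner)
  then have "cinner u v = inner u v *\<^sub>R 1 + inner ((- \<i>) *\<^sub>C u) v *\<^sub>R \<i>" for u
    by (simp add: complex_eq_iff)
  then show ?thesis
    by (simp, intro bounded_linear_add bounded_linear_scaleR_left[THEN bounded_linear_compose]
        bounded_linear_inner_left bounded_linear_compose[OF bounded_linear_inner_left]
        bounded_linear_scaleC)
qed

lemma bounded_linear_scaleC_left: "bounded_linear (\<lambda>c. c *\<^sub>C (u::'h::complex_hilbert_space))"
proof (rule bounded_linear_intro[where K = "norm u"])
  show "(r *\<^sub>R c) *\<^sub>C u = r *\<^sub>R c *\<^sub>C u" for r c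
    by (simp add: scaleR_conv_of_real scaleC_of_real flip: scaleC_scaleC)
qed (simp_all add: scaleC_add_left norm_scaleC)

text \<open>For a unit vector \<open>v\<close> this is the orthogonal projection onto the complex
  line through \<open>v\<close>.\<close>

definition rank_one :: "'h::complex_hilbert_space \<Rightarrow> 'h \<Rightarrow>\<^sub>L 'h" where
  "rank_one v = Blinfun (\<lambda>u. cinner u v *\<^sub>C v)"

lemma rank_one_apply [simp]: "blinfun_apply (rank_one v) u = cinner u v *\<^sub>C v"
  unfolding rank_one_def
  by (rule bounded_linear_Blinfun_apply[THEN fun_cong])
    (rule bounded_linear_compose[OF bounded_linear_scaleC_left bounded_linear_cinner_left])

text \<open>The unit ball is mapped into the multiples of \<open>v\<close> by scalars from a closed
  disc, a continuous image of a compact set.\<close>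

lemma rank_one_compact: "rank_one v \<in> compact_operators"
proof -
  obtain K where K: "\<And>u. cmod (cinner u v) \<le> norm u * K" "K \<ge> 0"
    using bounded_linear.nonneg_bounded[OF bounded_linear_cinner_left] by metis
  have "blinfun_apply (rank_one v) ` cball 0 1 \<subseteq> (\<lambda>c. c *\<^sub>C v) ` cball 0 K"
  proof clarsimp
    fix u :: 'a assume "norm u \<le> 1"
    then have "cmod (cinner u v) \<le> K"
      using K(1)[of u] mult_right_mono[of "norm u" 1 K] K(2) by simp
    then show "cinner u v *\<^sub>C v \<in> (\<lambda>c. c *\<^sub>C v) ` cball 0 K" by auto
  qed
  moreover have "compact ((\<lambda>c. c *\<^sub>C v) ` cball 0 K)"
    by (intro compact_continuous_image compact_cball linear_continuous_on bounded_linear_scaleC_left)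
  moreover have "complex_linear (rank_one v)"
    by (simp add: complex_linear_def cinner_scaleC_left scaleC_scaleC)
  ultimately show ?thesis unfolding compact_operators_iff by blast
qed

text \<open>The orthogonal projection onto the span of the \<open>e i\<close> if these are
  orthonormal and \<open>F\<close> is finite. For infinite \<open>F\<close> the sum takes its
  default value 0.\<close>

definition projection :: "('i \<Rightarrow> 'h::complex_hilbert_space) \<Rightarrow> 'i set \<Rightarrow> 'h \<Rightarrow>\<^sub>L 'h" where
  "projection e F = (\<Sum>i\<in>F. rank_one (e i))"

lemma projection_apply: "blinfun_apply (projection e F) u = (\<Sum>i\<in>F. cinner u (e i) *\<^sub>C e i)"
  by (simp add: projection_def blinfun.sum_left)

lemma projection_compact: "projection e F \<in> compact_operators"
  unfolding projection_def
  by (induction F rule: infinite_finite_induct)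
    (auto simp: zero_in_compact_operators compact_operators_add rank_one_compact)

text \<open>Each summand with \<open>w = e i\<close> is the real part of
  \<open>cinner u w * cinner w v\<close> on both sides.\<close>

lemma inner_projection:
  "inner (blinfun_apply (projection e F) u) v = inner u (blinfun_apply (projection e F) v)"
proof -
  have "inner (cinner u w *\<^sub>C w) v = inner u (cinner v w *\<^sub>C w)" for w
    by (simp add: inner_eq_Re_cinner cinner_scaleC_left cinner_scaleC_right
        cinner_commute[of w v] mult.commute)
  then show ?thesis
    by (simp add: projection_apply inner_sum_left inner_sum_right)
qed

lemma op_adjoint_projection: "op_adjoint (projection e F) = projection e F"
  by (intro op_adjoint_eqI compact_operators_complex_linear projection_compact inner_projection)

context
  fixes e :: "'i \<Rightarrow> 'h::complex_hilbert_space"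
  assumes onb: "orthonormal_basis e"
begin

lemma projection_basis:
  assumes "finite F" "i \<in> F"
  shows "blinfun_apply (projection e F) (e i) = e i"
proof -
  have "blinfun_apply (projection e F) (e i) = (\<Sum>j\<in>F. if j = i then e i else 0)"
    unfolding projection_apply
    using onb by (intro sum.cong) (auto simp: orthonormal_basis_def scaleC_of_real[of 1, simplified])
  then show ?thesis using assms by simp
qed

lemma projection_span:
  assumes "finite G" "F \<subseteq> G"
  shows "blinfun_apply (projection e G) (\<Sum>i\<in>F. c i *\<^sub>C e i) = (\<Sum>i\<in>F. c i *\<^sub>C e i)"
proof -
  have "complex_linear (projection e G)"
    by (rule compact_operators_complex_linear[OF projection_compact])
  then show ?thesis
    using assms by (auto simp: blinfun.sum_right complex_linear_def projection_basis subset_iff intro!: sum.cong)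
qed

text \<open>Idempotence and self-adjointness turn the squared norm of the projected vector into its
  inner product with \<open>u\<close>; Cauchy-Schwarz then applies.\<close>

lemma norm_projection_le:
  assumes "finite F"
  shows "norm (blinfun_apply (projection e F) u) \<le> norm u"
proof -
  let ?p = "blinfun_apply (projection e F) u"
  have "blinfun_apply (projection e F) ?p = ?p"
    using projection_span[OF assms order.refl, of "\<lambda>i. cinner u (e i)"]
    by (simp only: projection_apply)
  then have "norm ?p * norm ?p = inner u ?p"
    by (metis inner_projection power2_eq_square power2_norm_eq_inner)
  also have "\<dots> \<le> norm u * norm ?p" by (rule norm_cauchy_schwarz)
  finally show ?thesis by (cases "?p = 0") auto
qed

text \<open>A finite combination close to \<open>u\<close> is fixed by the projection, and the
  remainder is controlled by contractivity. The bound covers all larger index sets so that finitely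
  many choices of \<open>F\<close> can later be united.\<close>

lemma projection_approx:
  assumes "\<epsilon> > 0"
  shows "\<exists>F. finite F \<and> (\<forall>G. finite G \<and> F \<subseteq> G \<longrightarrow>
           norm (blinfun_apply (projection e G) u - u) < \<epsilon>)"
proof -
  have "u \<in> closure {\<Sum>i\<in>F. c i *\<^sub>C e i | F c. finite F}"
    using onb by (simp add: orthonormal_basis_def)
  then obtain F c where F: "finite F" and "dist (\<Sum>i\<in>F. c i *\<^sub>C e i) u < \<epsilon> / 2"
    using assms unfolding closure_approachable by (auto dest!: spec[of _ "\<epsilon>/2"])
  moreover define s where "s = (\<Sum>i\<in>F. c i *\<^sub>C e i)"
  ultimately have close: "norm (s - u) < \<epsilon> / 2"
    by (simp add: dist_norm)
  have "norm (blinfun_apply (projection e G) u - u) < \<epsilon>" if G: "finite G" "F \<subseteq> G" for G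
  proof -
    let ?P = "blinfun_apply (projection e G)"
    have "?P u - u = (s - u) - ?P (s - u)"
      using projection_span[OF G] by (simp add: s_def blinfun.diff_right)
    then have "norm (?P u - u) \<le> norm (s - u) + norm (?P (s - u))"
      by (metis norm_triangle_ineq4)
    then show ?thesis
      using norm_projection_le[OF G(1), of "s - u"] close by argo
  qed
  then show ?thesis using F by blast
qed

text \<open>The finite-rank projections converge to the identity pointwise, hence uniformly on the
  totally bounded image of the unit ball.\<close>

lemma compact_operator_approx:
  assumes A: "A \<in> compact_operators" and "\<epsilon> > 0"
  shows "\<exists>F. finite F \<and> norm ((projection e F o\<^sub>L A) - A) \<le> \<epsilon>"
proof -
  obtain K where K: "compact K" "blinfun_apply A ` cball 0 1 \<subseteq> K"
    using A by (auto simp: compact_operators_iff)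
  obtain k where k: "finite k" "K \<subseteq> (\<Union>x\<in>k. ball x (\<epsilon> / 3))"
    using compact_imp_seq_compact[OF K(1)] \<open>\<epsilon> > 0\<close>
    by (metis seq_compact_imp_totally_bounded zero_less_divide_iff zero_less_numeral)
  have "\<exists>F. finite F \<and> (\<forall>G. finite G \<and> F \<subseteq> G \<longrightarrow>
           norm (blinfun_apply (projection e G) x - x) < \<epsilon> / 3)" for x
    using \<open>\<epsilon> > 0\<close> by (intro projection_approx) simp
  then obtain f where f: "\<And>x. finite (f x)"
    "\<And>x G. finite G \<Longrightarrow> f x \<subseteq> G \<Longrightarrow> norm (blinfun_apply (projection e G) x - x) < \<epsilon> / 3"
    by metis
  \<comment> \<open>One index set that serves all centres of the finite net, since \<open>f\<close>
    allows supersets.\<close>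
  define G where "G = (\<Union>x\<in>k. f x)"
  have G: "finite G" using k f by (simp add: G_def)
  let ?P = "blinfun_apply (projection e G)"
  have unit: "norm (?P w - w) \<le> \<epsilon>" if w: "w \<in> K" for w
  proof -
    obtain x where x: "x \<in> k" "dist x w < \<epsilon> / 3" using subsetD[OF k(2) w] unfolding UN_iff mem_ball by blast
    have "norm (?P x - x) < \<epsilon> / 3" using x by (intro f G) (auto simp: G_def)
    moreover have "norm (?P (w - x)) < \<epsilon> / 3" "norm (x - w) < \<epsilon> / 3"
      using norm_projection_le[OF G, of "w - x"] x by (simp_all add: dist_norm norm_minus_commute)
    moreover have "?P w - w = ?P (w - x) + (?P x - x) + (x - w)"
      by (simp add: blinfun.diff_right)
    then have "norm (?P w - w) \<le> norm (?P (w - x)) + norm (?P x - x) + norm (x - w)"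
      using norm_triangle_ineq[of "?P (w - x) + (?P x - x)" "x - w"]
        norm_triangle_ineq[of "?P (w - x)" "?P x - x"] by simp
    ultimately show ?thesis by argo
  qed
  have "norm ((projection e G o\<^sub>L A) - A) \<le> \<epsilon>"
  proof (rule norm_blinfun_bound)
    fix u
    show "norm (blinfun_apply ((projection e G o\<^sub>L A) - A) u) \<le> \<epsilon> * norm u"
    proof (cases "u = 0")
      case False
      define v where "v = u /\<^sub>R norm u"
      have "norm v = 1" using False by (simp add: v_def)
      then have "norm (?P (blinfun_apply A v) - blinfun_apply A v) \<le> \<epsilon>"
        using K by (intro unit) auto
      moreover have u: "u = norm u *\<^sub>R v" using False by (simp add: v_def)
      have "blinfun_apply ((projection e G o\<^sub>L A) - A) u =
          norm u *\<^sub>R (?P (blinfun_apply A v) - blinfun_apply A v)"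
        by (subst u) (simp only: blinfun.diff_left blinfun.scaleR_right
            blinfun_apply_blinfun_compose scaleR_diff_right)
      ultimately show ?thesis by (simp add: mult.commute[of \<epsilon>] mult_left_mono)
    qed simp
  qed (use \<open>\<epsilon> > 0\<close> in simp)
  then show ?thesis using G by blast
qed

text \<open>Supplies a nonzero compact operator, hence an element of the module with nonzero first
  entry.\<close>

lemma projection_nonzero: "projection e {i} \<noteq> 0"
proof
  assume "projection e {i} = 0"
  then have "e i = 0" using projection_basis[of "{i}" i] by simp
  moreover have "inner (e i) (e i) = 1"
    using onb by (simp add: inner_eq_Re_cinner orthonormal_basis_def)
  ultimately show False by simp
qed

end

section \<open>The norm of the Hilbert module\<close>

lemma std_module_compact: "x \<in> std_module \<Longrightarrow> x j \<in> compact_operators"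
  and std_module_complex_linear: "x \<in> std_module \<Longrightarrow> complex_linear (x j)"
  and std_module_sums: "x \<in> std_module \<Longrightarrow> (\<lambda>j. op_adjoint (x j) o\<^sub>L x j) sums mod_form x x"
  by (auto simp: std_module_def mod_form_def compact_operators_complex_linear summable_sums)

text \<open>Summability depends only on the tail. With the zero sequence as \<open>x\<close>, this
  covers all finitely supported sequences.\<close>

lemma std_module_finite_change:
  assumes "x \<in> std_module" "\<And>j. x' j \<in> compact_operators" "\<And>j. j \<ge> N \<Longrightarrow> x' j = x j"
  shows "x' \<in> std_module"
proof -
  have "summable (\<lambda>j. op_adjoint (x' j) o\<^sub>L x' j) \<longleftrightarrow> summable (\<lambda>j. op_adjoint (x j) o\<^sub>L x j)"
    by (intro summable_cong eventually_sequentiallyI[of N]) (simp add: assms(3))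
  then show ?thesis using assms by (simp add: std_module_def)
qed

lemma std_module_zero: "(\<lambda>j. 0) \<in> std_module"
  by (simp add: std_module_def zero_in_compact_operators)

lemma std_module_scaleR:
  assumes "x \<in> std_module"
  shows "(\<lambda>j. r *\<^sub>R x j) \<in> std_module"
    and "mod_form (\<lambda>j. r *\<^sub>R x j) (\<lambda>j. r *\<^sub>R x j) = r\<^sup>2 *\<^sub>R mod_form x x"
proof -
  have "op_adjoint (r *\<^sub>R x j) o\<^sub>L (r *\<^sub>R x j) = r\<^sup>2 *\<^sub>R (op_adjoint (x j) o\<^sub>L x j)" for j
    using std_module_complex_linear[OF assms]
    by (intro blinfun_eqI)
      (simp add: op_adjoint_scaleR blinfun.scaleR_left blinfun.scaleR_right power2_eq_square)
  then have "(\<lambda>j. op_adjoint (r *\<^sub>R x j) o\<^sub>L (r *\<^sub>R x j)) sums (r\<^sup>2 *\<^sub>R mod_form x x)"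
    using sums_scaleR_right[OF std_module_sums[OF assms], of "r\<^sup>2"] by simp
  then show "(\<lambda>j. r *\<^sub>R x j) \<in> std_module"
    and "mod_form (\<lambda>j. r *\<^sub>R x j) (\<lambda>j. r *\<^sub>R x j) = r\<^sup>2 *\<^sub>R mod_form x x"
    using std_module_compact[OF assms]
    by (auto simp: std_module_def compact_operators_scaleR sums_iff mod_form_def)
qed

lemma mod_norm_scaleR:
  assumes "x \<in> std_module"
  shows "mod_norm (\<lambda>j. r *\<^sub>R x j) = \<bar>r\<bar> * mod_norm x"
  by (simp add: mod_norm_def std_module_scaleR[OF assms] real_sqrt_mult)

lemma mod_norm_nonneg [simp]: "mod_norm x \<ge> 0"
  by (simp add: mod_norm_def)

text \<open>The norm of the positive operator \<open>mod_form x x\<close> is the supremum of its quadratic form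
  over the unit ball, so \<open>mod_norm x\<close> is the supremum of the \<open>\<ell>\<^sub>2\<close> norms of \<open>(x j u)\<^sub>j\<close>.\<close>

lemma L2_set_le_mod_norm:
  assumes "x \<in> std_module"
  shows "L2_set (\<lambda>j. norm (blinfun_apply (x j) u)) {..<N} \<le> mod_norm x * norm u"
proof -
  have "(\<lambda>j. inner u (blinfun_apply (op_adjoint (x j) o\<^sub>L x j) u)) sums
      inner u (blinfun_apply (mod_form x x) u)"
    by (intro bounded_linear.sums[OF bounded_linear_inner_right]
        bounded_linear.sums[OF blinfun.bounded_linear_left] std_module_sums assms)
  then have "(\<lambda>j. (norm (blinfun_apply (x j) u))\<^sup>2) sums inner u (blinfun_apply (mod_form x x) u)"
    by (simp add: inner_op_adjoint[OF std_module_complex_linear[OF assms]] power2_norm_eq_inner)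
  then have "(\<Sum>j<N. (norm (blinfun_apply (x j) u))\<^sup>2) \<le> inner u (blinfun_apply (mod_form x x) u)"
    using sum_le_suminf by (metis finite_lessThan sums_iff zero_le_power2)
  also have "\<dots> \<le> norm u * norm (blinfun_apply (mod_form x x) u)"
    by (rule norm_cauchy_schwarz)
  also have "\<dots> \<le> norm u * (norm (mod_form x x) * norm u)"
    by (intro mult_left_mono norm_blinfun norm_ge_zero)
  also have "\<dots> = (mod_norm x * norm u)\<^sup>2"
    by (simp add: mod_norm_def power_mult_distrib power2_eq_square mult_ac)
  finally show ?thesis
    by (simp add: L2_set_def real_le_lsqrt sum_nonneg)
qed

text \<open>Cauchy-Schwarz in \<ell>2 bounds the whole sesquilinear form of
  \<open>mod_form x x\<close>, not only its diagonal, so its operator norm can be read off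
  directly.\<close>

lemma mod_norm_leI:
  assumes x: "x \<in> std_module" and "R \<ge> 0"
    and bound: "\<And>u N. L2_set (\<lambda>j. norm (blinfun_apply (x j) u)) {..<N} \<le> R * norm u"
  shows "mod_norm x \<le> R"
proof -
  let ?B = "mod_form x x"
  have form: "inner v (blinfun_apply ?B u) \<le> R\<^sup>2 * norm u * norm v" for u v
  proof -
    have "(\<lambda>j. inner v (blinfun_apply (op_adjoint (x j) o\<^sub>L x j) u)) sums
        inner v (blinfun_apply ?B u)"
      by (intro bounded_linear.sums[OF bounded_linear_inner_right]
          bounded_linear.sums[OF blinfun.bounded_linear_left] std_module_sums x)
    then have "(\<lambda>N. \<Sum>j<N. inner (blinfun_apply (x j) v) (blinfun_apply (x j) u))
        \<longlonglongrightarrow> inner v (blinfun_apply ?B u)"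
      by (simp add: inner_op_adjoint[OF std_module_complex_linear[OF x]] sums_def)
    moreover have "(\<Sum>j<N. inner (blinfun_apply (x j) v) (blinfun_apply (x j) u))
        \<le> R\<^sup>2 * norm u * norm v" for N
    proof -
      have "(\<Sum>j<N. inner (blinfun_apply (x j) v) (blinfun_apply (x j) u)) \<le>
          (\<Sum>j<N. \<bar>norm (blinfun_apply (x j) v)\<bar> * \<bar>norm (blinfun_apply (x j) u)\<bar>)"
        by (intro sum_mono) (simp add: norm_cauchy_schwarz)
      also have "\<dots> \<le> L2_set (\<lambda>j. norm (blinfun_apply (x j) v)) {..<N} *
          L2_set (\<lambda>j. norm (blinfun_apply (x j) u)) {..<N}"
        by (rule L2_set_mult_ineq)
      also have "\<dots> \<le> (R * norm v) * (R * norm u)"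
        using \<open>R \<ge> 0\<close> by (intro mult_mono bound) auto
      finally show ?thesis by (simp add: power2_eq_square mult_ac)
    qed
    ultimately show ?thesis by (intro LIMSEQ_le_const2) blast+
  qed
  have "norm ?B \<le> R\<^sup>2"
  proof (rule norm_blinfun_bound)
    fix u
    let ?w = "blinfun_apply ?B u"
    \<comment> \<open>The form bound at \<open>v = ?w\<close>; one factor \<open>norm ?w\<close> is
      then cancelled.\<close>
    have "norm ?w * norm ?w \<le> R\<^sup>2 * norm u * norm ?w"
      using form[of ?w u] by (simp flip: power2_norm_eq_inner power2_eq_square)
    then show "norm ?w \<le> R\<^sup>2 * norm u"
      by (cases "?w = 0") auto
  qed simp
  then show ?thesis using \<open>R \<ge> 0\<close> by (simp add: mod_norm_def real_le_lsqrt)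
qed

text \<open>Minkowski's inequality at each vector \<open>u\<close>. Membership of the sum is assumed
  because \<open>std_module_add\<close> derives it from this inequality for finite blocks.\<close>

lemma mod_norm_triangle_of_mem:
  assumes "x \<in> std_module" "y \<in> std_module" "(\<lambda>j. x j + y j) \<in> std_module"
  shows "mod_norm (\<lambda>j. x j + y j) \<le> mod_norm x + mod_norm y"
proof (rule mod_norm_leI[OF assms(3)])
  fix u N
  have "L2_set (\<lambda>j. norm (blinfun_apply (x j + y j) u)) {..<N} \<le>
      L2_set (\<lambda>j. norm (blinfun_apply (x j) u) + norm (blinfun_apply (y j) u)) {..<N}"
    by (intro L2_set_mono) (auto simp: blinfun.add_left norm_triangle_ineq)
  also have "\<dots> \<le> L2_set (\<lambda>j. norm (blinfun_apply (x j) u)) {..<N} +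
      L2_set (\<lambda>j. norm (blinfun_apply (y j) u)) {..<N}"
    by (rule L2_set_triangle_ineq)
  also have "\<dots> \<le> (mod_norm x + mod_norm y) * norm u"
    unfolding distrib_right by (intro add_mono L2_set_le_mod_norm assms)
  finally show "L2_set (\<lambda>j. norm (blinfun_apply (x j + y j) u)) {..<N} \<le>
      (mod_norm x + mod_norm y) * norm u" .
qed simp

text \<open>Makes the coordinates continuous; at entry 0 it shows that being nonzero there is an
  open condition.\<close>

lemma norm_component_le_mod_norm:
  assumes "x \<in> std_module"
  shows "norm (x j) \<le> mod_norm x"
proof (rule norm_blinfun_bound)
  fix u
  have "norm (blinfun_apply (x j) u) \<le> L2_set (\<lambda>j. norm (blinfun_apply (x j) u)) {..<Suc j}"
    by (intro member_le_L2_set) auto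
  also have "\<dots> \<le> mod_norm x * norm u" by (rule L2_set_le_mod_norm[OF assms])
  finally show "norm (blinfun_apply (x j) u) \<le> mod_norm x * norm u" .
qed simp

section \<open>Single entries, tails and finite blocks\<close>

lemma std_module_single:
  assumes "a \<in> compact_operators"
  shows "(\<lambda>j. if j = k then a else 0) \<in> std_module"
  by (rule std_module_finite_change[OF std_module_zero, where N = "Suc k"])
    (use assms zero_in_compact_operators in auto)

lemma mod_norm_single_le:
  assumes "a \<in> compact_operators"
  shows "mod_norm (\<lambda>j. if j = k then a else 0) \<le> norm a"
proof (rule mod_norm_leI[OF std_module_single[OF assms]])
  fix u N
  have "L2_set (\<lambda>j. norm (blinfun_apply (if j = k then a else 0) u)) {..<N} =
      sqrt (\<Sum>j<N. if j = k then (norm (blinfun_apply a u))\<^sup>2 else 0)"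
    unfolding L2_set_def by (intro arg_cong[of _ _ sqrt] sum.cong) auto
  also have "\<dots> \<le> norm (blinfun_apply a u)" by simp
  also have "\<dots> \<le> norm a * norm u" by (rule norm_blinfun)
  finally show "L2_set (\<lambda>j. norm (blinfun_apply (if j = k then a else 0) u)) {..<N} \<le> norm a * norm u" .
qed simp

lemma std_module_tail:
  assumes "x \<in> std_module"
  shows "(\<lambda>j. if j < m then 0 else x j) \<in> std_module"
  by (rule std_module_finite_change[OF assms, where N = m])
    (use std_module_compact[OF assms] zero_in_compact_operators in auto)

text \<open>The form of the tail is the remainder of the norm-convergent series for
  \<open>mod_form x x\<close>.\<close>

lemma mod_norm_tail_tendsto:
  assumes "x \<in> std_module"
  shows "(\<lambda>m. mod_norm (\<lambda>j. if j < m then 0 else x j)) \<longlonglongrightarrow> 0"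
proof -
  let ?f = "\<lambda>j. op_adjoint (x j) o\<^sub>L x j"
  have "mod_form (\<lambda>j. if j < m then 0 else x j) (\<lambda>j. if j < m then 0 else x j) =
      mod_form x x - sum ?f {..<m}" for m
  proof -
    have "(\<lambda>j. ?f j - (if j \<in> {..<m} then ?f j else 0)) sums (mod_form x x - sum ?f {..<m})"
      by (intro sums_diff std_module_sums assms sums_If_finite_set) simp
    moreover have "?f j - (if j \<in> {..<m} then ?f j else 0) =
        op_adjoint (if j < m then 0 else x j) o\<^sub>L (if j < m then 0 else x j)" for j
      by (auto intro: blinfun_eqI)
    ultimately show ?thesis by (simp add: mod_form_def sums_iff)
  qed
  moreover have "(\<lambda>m. sqrt (norm (mod_form x x - sum ?f {..<m}))) \<longlonglongrightarrow>
      sqrt (norm (mod_form x x - mod_form x x))"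
    using std_module_sums[OF assms] unfolding sums_def by (intro tendsto_intros)
  ultimately show ?thesis by (simp add: mod_norm_def)
qed

text \<open>Blocks express the Cauchy sums of the defining series as module norms, for any sequence
  of compact operators.\<close>

lemma
  fixes x :: "'h::complex_hilbert_space op_seq"
  assumes "\<And>j. x j \<in> compact_operators"
  shows std_module_block: "(\<lambda>j. if j \<in> {m..<n} then x j else 0) \<in> std_module"
    and mod_norm_block: "mod_norm (\<lambda>j. if j \<in> {m..<n} then x j else 0) =
      sqrt (norm (\<Sum>j=m..<n. op_adjoint (x j) o\<^sub>L x j))"
proof -
  let ?z = "\<lambda>j. if j \<in> {m..<n} then x j else 0"
  show "?z \<in> std_module"
    by (rule std_module_finite_change[OF std_module_zero, where N = n])
      (use assms zero_in_compact_operators in auto)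
  have "op_adjoint (?z j) o\<^sub>L ?z j = (if j \<in> {m..<n} then op_adjoint (x j) o\<^sub>L x j else 0)" for j
    by (auto intro: blinfun_eqI)
  then have "mod_form ?z ?z = (\<Sum>j. if j \<in> {m..<n} then op_adjoint (x j) o\<^sub>L x j else 0)"
    unfolding mod_form_def by presburger
  also have "\<dots> = (\<Sum>j=m..<n. op_adjoint (x j) o\<^sub>L x j)"
    by (rule sums_unique[symmetric], rule sums_If_finite_set) simp
  finally show "mod_norm ?z = sqrt (norm (\<Sum>j=m..<n. op_adjoint (x j) o\<^sub>L x j))"
    by (simp add: mod_norm_def)
qed

text \<open>Cauchy criterion: the triangle inequality for blocks makes the Cauchy sums of
  \<open>x + y\<close> small once those of \<open>x\<close> and \<open>y\<close> are.\<close>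

lemma std_module_add:
  assumes x: "x \<in> std_module" and y: "y \<in> std_module"
  shows "(\<lambda>j. x j + y j) \<in> std_module"
proof -
  let ?form = "\<lambda>x m n. \<Sum>j=m..<n. op_adjoint (x j) o\<^sub>L x j"
  let ?block = "\<lambda>x m n j. if j \<in> {m..<n} then x j else 0"
  have compact: "x j \<in> compact_operators" "y j \<in> compact_operators"
    "x j + y j \<in> compact_operators" for j
    using std_module_compact[OF x] std_module_compact[OF y] by (auto intro: compact_operators_add)
  have triangle: "sqrt (norm (?form (\<lambda>j. x j + y j) m n)) \<le>
      sqrt (norm (?form x m n)) + sqrt (norm (?form y m n))" for m n
  proof -
    have sum: "?block (\<lambda>j. x j + y j) m n = (\<lambda>j. ?block x m n j + ?block y m n j)"
      by auto
    have "mod_norm (?block (\<lambda>j. x j + y j) m n) \<le> mod_norm (?block x m n) + mod_norm (?block y m n)"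
      unfolding sum
      by (rule mod_norm_triangle_of_mem) (use std_module_block[of x] std_module_block[of y]
          std_module_block[of "\<lambda>j. x j + y j"] compact in \<open>simp_all only: flip: sum\<close>)
    then show ?thesis by (simp only: mod_norm_block compact)
  qed
  have "summable (\<lambda>j. op_adjoint (x j + y j) o\<^sub>L (x j + y j))"
    unfolding summable_Cauchy
  proof (intro allI impI)
    fix \<epsilon> :: real assume "\<epsilon> > 0"
    \<comment> \<open>A quarter of \<open>\<epsilon>\<close> suffices for each, since
      \<open>2 * sqrt (\<epsilon> / 4) = sqrt \<epsilon>\<close>.\<close>
    have small: "\<exists>N. \<forall>m\<ge>N. \<forall>n. norm (?form w m n) < \<epsilon> / 4" if "w \<in> std_module" for w :: "'a op_seq"
    proof -
      have "\<forall>\<epsilon>>0. \<exists>N. \<forall>m\<ge>N. \<forall>n. norm (?form w m n) < \<epsilon>"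
        using that unfolding std_module_def summable_Cauchy by simp
      from this[rule_format, of "\<epsilon> / 4"] \<open>\<epsilon> > 0\<close> show ?thesis by simp
    qed
    obtain M N where M: "\<And>m n. m \<ge> M \<Longrightarrow> norm (?form x m n) < \<epsilon> / 4"
      and N: "\<And>m n. m \<ge> N \<Longrightarrow> norm (?form y m n) < \<epsilon> / 4"
      using small[OF x] small[OF y] by blast
    have "norm (?form (\<lambda>j. x j + y j) m n) < \<epsilon>" if "m \<ge> max M N" for m n
    proof -
      have "sqrt (norm (?form x m n)) < sqrt (\<epsilon> / 4)" "sqrt (norm (?form y m n)) < sqrt (\<epsilon> / 4)"
        using M[of m n] N[of m n] that by simp_all
      with triangle[of m n] have "sqrt (norm (?form (\<lambda>j. x j + y j) m n)) < 2 * sqrt (\<epsilon> / 4)"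
        by linarith
      also have "\<dots> = sqrt \<epsilon>" by (simp add: real_sqrt_divide)
      finally show ?thesis by simp
    qed
    then show "\<exists>N. \<forall>m\<ge>N. \<forall>n. norm (?form (\<lambda>j. x j + y j) m n) < \<epsilon>" by blast
  qed
  then show ?thesis using compact by (simp add: std_module_def)
qed

lemma std_module_diff:
  assumes "x \<in> std_module" "y \<in> std_module"
  shows "(\<lambda>j. x j - y j) \<in> std_module"
  using std_module_add[OF assms(1) std_module_scaleR(1)[OF assms(2), of "-1"]] by simp

lemma mod_norm_triangle:
  assumes "x \<in> std_module" "y \<in> std_module"
  shows "mod_norm (\<lambda>j. x j + y j) \<le> mod_norm x + mod_norm y"
  by (intro mod_norm_triangle_of_mem std_module_add assms)

lemma mod_norm_diff_le:
  assumes "x \<in> std_module" "y \<in> std_module"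
  shows "mod_norm (\<lambda>j. x j - y j) \<le> mod_norm x + mod_norm y"
  using mod_norm_triangle[OF assms(1) std_module_scaleR(1)[OF assms(2), of "-1"]]
    mod_norm_scaleR[OF assms(2), of "-1"] by simp

section \<open>The doubled shift\<close>

definition truncate_insert :: "nat \<Rightarrow> nat \<Rightarrow> ('h::complex_hilbert_space \<Rightarrow>\<^sub>L 'h) \<Rightarrow> 'h op_seq \<Rightarrow> 'h op_seq" where
  "truncate_insert m k a x = (\<lambda>j. if j < m then x j else if j = k then a else 0)"

text \<open>Cutting off and inserting cost at most \<open>\<eta> / 2\<close> each, and normalising
  costs at most another \<open>\<eta>\<close>. The threshold \<open>M\<close> is independent of
  \<open>k\<close> and \<open>a\<close>, so position and entry may be chosen after
  \<open>m\<close>.\<close>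

lemma sphere_perturbation:
  assumes x: "x \<in> mod_sphere" and "0 < \<eta>" "\<eta> < 1"
  shows "\<exists>M. \<forall>m\<ge>M. \<forall>k\<ge>m. \<forall>a\<in>compact_operators. norm a \<le> \<eta> / 2 \<longrightarrow>
    (\<exists>s. \<bar>s - 1\<bar> \<le> \<eta> \<and> (\<lambda>j. (1/s) *\<^sub>R truncate_insert m k a x j) \<in> mod_sphere \<and>
      mod_norm (\<lambda>j. (1/s) *\<^sub>R truncate_insert m k a x j - x j) \<le> 2 * \<eta>)"
proof -
  have xM: "x \<in> std_module" and x1: "mod_norm x = 1"
    using x by (auto simp: mod_sphere_def)
  obtain M where M: "\<And>m. m \<ge> M \<Longrightarrow> mod_norm (\<lambda>j. if j < m then 0 else x j) < \<eta> / 2"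
    using order_tendstoD(2)[OF mod_norm_tail_tendsto[OF xM], of "\<eta> / 2"] \<open>0 < \<eta>\<close>
    by (auto simp: eventually_sequentially)
  have "\<exists>s. \<bar>s - 1\<bar> \<le> \<eta> \<and> (\<lambda>j. (1/s) *\<^sub>R truncate_insert m k a x j) \<in> mod_sphere \<and>
      mod_norm (\<lambda>j. (1/s) *\<^sub>R truncate_insert m k a x j - x j) \<le> 2 * \<eta>"
    if mk: "m \<ge> M" "k \<ge> m" and a: "a \<in> compact_operators" "norm a \<le> \<eta> / 2" for m k a
  proof -
    define z where "z = truncate_insert m k a x"
    define tail where "tail = (\<lambda>j. if j < m then 0 else x j)"
    define single where "single = (\<lambda>j. if j = k then a else 0)"
    have z_compact: "z j \<in> compact_operators" for j
      using std_module_compact[OF xM] a(1) zero_in_compact_operators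
      by (auto simp: z_def truncate_insert_def)
    have tail: "tail \<in> std_module" "mod_norm tail < \<eta> / 2"
      unfolding tail_def by (rule std_module_tail[OF xM], rule M[OF mk(1)])
    have single: "single \<in> std_module" "mod_norm single \<le> \<eta> / 2"
      unfolding single_def using std_module_single[OF a(1)] order_trans[OF mod_norm_single_le[OF a(1)] a(2)]
      by blast+
    have zM: "z \<in> std_module"
      by (rule std_module_finite_change[OF std_module_zero z_compact, where N = "Suc (max m k)"])
        (auto simp: z_def truncate_insert_def)
    define d where "d = (\<lambda>j. z j - x j)"
    have dM: "d \<in> std_module" unfolding d_def by (rule std_module_diff[OF zM xM])
    \<comment> \<open>Here \<open>k \<ge> m\<close> matters: for smaller \<open>k\<close> the first
      branch of \<open>truncate_insert\<close> would discard \<open>a\<close>.\<close>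
    have "d = (\<lambda>j. single j - tail j)"
      using mk(2) by (auto simp: d_def z_def truncate_insert_def tail_def single_def)
    then have d: "mod_norm d \<le> \<eta>"
      using mod_norm_diff_le[OF single(1) tail(1)] single(2) tail(2) by simp
    define s where "s = mod_norm z"
    have "s \<le> mod_norm x + mod_norm d"
      using mod_norm_triangle[OF xM dM] by (simp add: d_def s_def)
    moreover have "mod_norm x \<le> s + mod_norm d"
      using mod_norm_diff_le[OF zM dM] by (simp add: d_def s_def)
    ultimately have s: "\<bar>s - 1\<bar> \<le> \<eta>" using x1 d by linarith
    then have "s > 0" using \<open>\<eta> < 1\<close> by linarith
    have "mod_norm (\<lambda>j. (1/s) *\<^sub>R z j) = 1"
      using mod_norm_scaleR[OF zM, of "1/s"] \<open>s > 0\<close> by (simp add: s_def)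
    then have sphere: "(\<lambda>j. (1/s) *\<^sub>R z j) \<in> mod_sphere"
      using std_module_scaleR(1)[OF zM] by (simp add: mod_sphere_def)
    have split: "(\<lambda>j. (1/s) *\<^sub>R z j - x j) = (\<lambda>j. (1/s - 1) *\<^sub>R z j + d j)"
      by (auto simp: d_def algebra_simps)
    \<comment> \<open>As \<open>s\<close> is the norm of \<open>z\<close>, this is the distance from
      \<open>z\<close> to its normalisation.\<close>
    have "\<bar>1/s - 1\<bar> * s = \<bar>s - 1\<bar>"
      using \<open>s > 0\<close> by (simp add: abs_if field_simps)
    then have "mod_norm (\<lambda>j. (1/s) *\<^sub>R z j - x j) \<le> \<bar>s - 1\<bar> + mod_norm d"
      using mod_norm_triangle[OF std_module_scaleR(1)[OF zM, of "1/s - 1"] dM]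
        mod_norm_scaleR[OF zM, of "1/s - 1"]
      unfolding split by (simp only: s_def)
    also have "\<dots> \<le> 2 * \<eta>" using s d by simp
    finally show ?thesis using s sphere by (auto simp: z_def)
  qed
  then show ?thesis by blast
qed

section \<open>The operator and the form on its iterates\<close>

definition double_shift :: "'h::complex_hilbert_space op_seq \<Rightarrow> 'h op_seq" where
  "double_shift x = (\<lambda>j. case j of 0 \<Rightarrow> 0 | Suc i \<Rightarrow> 2 *\<^sub>R x i)"

lemma double_shift_funpow:
  "(double_shift ^^ n) x j = (if j < n then 0 else 2 ^ n *\<^sub>R x (j - n))"
  by (induction n arbitrary: j) (auto simp: double_shift_def split: nat.split)

lemma op_scaleC_scaleR: "op_scaleC c (r *\<^sub>R A) = r *\<^sub>R op_scaleC c A"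
  by (rule blinfun_eqI)
    (simp add: op_scaleC.rep_eq blinfun.scaleR_left scaleC_scaleC mult.commute flip: scaleC_of_real)

lemma op_scaleC_zero: "op_scaleC c 0 = 0"
  by (rule blinfun_eqI) (simp add: op_scaleC.rep_eq)

text \<open>Apart from a leading zero term, the series is that of the doubled sequence.\<close>

lemma
  assumes "x \<in> std_module"
  shows double_shift_std_module: "double_shift x \<in> std_module"
    and mod_norm_double_shift: "mod_norm (double_shift x) = 2 * mod_norm x"
proof -
  let ?y = "\<lambda>j. 2 *\<^sub>R x j"
  have "(\<lambda>j. op_adjoint (?y j) o\<^sub>L ?y j) sums mod_form ?y ?y"
    by (intro std_module_sums std_module_scaleR assms)
  then have sums: "(\<lambda>j. op_adjoint (double_shift x j) o\<^sub>L double_shift x j) sums mod_form ?y ?y"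
    using sums_Suc[of "\<lambda>j. op_adjoint (double_shift x j) o\<^sub>L double_shift x j" "mod_form ?y ?y"]
    by (simp add: double_shift_def)
  have "double_shift x j \<in> compact_operators" for j
    using std_module_compact[OF assms]
    by (auto simp: double_shift_def zero_in_compact_operators compact_operators_scaleR split: nat.split)
  then show "double_shift x \<in> std_module"
    using sums by (auto simp: std_module_def sums_iff)
  have "mod_norm (double_shift x) = mod_norm ?y"
    using sums by (simp add: mod_norm_def mod_form_def sums_iff)
  then show "mod_norm (double_shift x) = 2 * mod_norm x"
    by (simp add: mod_norm_scaleR[OF assms])
qed

lemma bounded_operator_double_shift: "bounded_operator double_shift"
  unfolding bounded_operator_def
proof (intro conjI ballI allI exI[of _ 2])
  show "double_shift (\<lambda>j. x j + y j) = (\<lambda>j. double_shift x j + double_shift y j)" for x y :: "'a op_seq"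
    by (auto simp: double_shift_def scaleR_add_right split: nat.split)
  show "double_shift (\<lambda>j. op_scaleC c (x j)) = (\<lambda>j. op_scaleC c (double_shift x j))" for c and x :: "'a op_seq"
    by (auto simp: double_shift_def op_scaleC_scaleR op_scaleC_zero split: nat.split)
qed (simp_all add: double_shift_std_module mod_norm_double_shift)

text \<open>The shifted sequence is supported in the positions from \<open>n\<close> to
  \<open>n + m\<close>, the other one below \<open>m\<close> and at \<open>n + m\<close>. As
  \<open>m \<le> n\<close>, only position \<open>n + m\<close> is common.\<close>

lemma mod_form_double_shift_truncate_insert:
  fixes x y :: "'h::complex_hilbert_space op_seq"
  assumes "m \<le> n" and "complex_linear b"
  shows "mod_form ((double_shift ^^ n) (\<lambda>j. r *\<^sub>R truncate_insert m m a x j))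
      (\<lambda>j. q *\<^sub>R truncate_insert m (n + m) b y j) = (r * q * 2 ^ n) *\<^sub>R (op_adjoint b o\<^sub>L a)"
proof -
  have "op_adjoint (q *\<^sub>R truncate_insert m (n + m) b y j) o\<^sub>L
      (double_shift ^^ n) (\<lambda>j. r *\<^sub>R truncate_insert m m a x j) j =
      (if j = n + m then (r * q * 2 ^ n) *\<^sub>R (op_adjoint b o\<^sub>L a) else 0)" for j
  proof -
    consider "j < n" | "n \<le> j" "j \<noteq> n + m" | "j = n + m" by linarith
    then show ?thesis
    proof cases
      case 3
      then show ?thesis
        by (intro blinfun_eqI) (simp add: double_shift_funpow truncate_insert_def blinfun.scaleR_left
            blinfun.scaleR_right op_adjoint_scaleR[OF assms(2)])
    qed (use assms(1) in \<open>auto simp: double_shift_funpow truncate_insert_def intro!: blinfun_eqI\<close>)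
  qed
  then have "mod_form ((double_shift ^^ n) (\<lambda>j. r *\<^sub>R truncate_insert m m a x j))
      (\<lambda>j. q *\<^sub>R truncate_insert m (n + m) b y j) =
      (\<Sum>j. if j = n + m then (r * q * 2 ^ n) *\<^sub>R (op_adjoint b o\<^sub>L a) else 0)"
    by (simp add: mod_form_def)
  also have "\<dots> = (r * q * 2 ^ n) *\<^sub>R (op_adjoint b o\<^sub>L a)"
    by (rule sums_unique[symmetric], rule sums_single)
  finally show ?thesis .
qed

section \<open>Values of the form near a prescribed compact operator\<close>

lemma inverse_product_near_one:
  fixes s t \<eta> :: real
  assumes "\<bar>s - 1\<bar> \<le> \<eta>" "\<bar>t - 1\<bar> \<le> \<eta>" "\<eta> \<le> 1/4"
  shows "\<bar>1 / s * (1 / t) - 1\<bar> \<le> 4 * \<eta>"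
proof -
  have pos: "s \<ge> 3/4" "t \<ge> 3/4" and "t \<le> 5/4" using assms by linarith+
  have st: "s * t \<ge> 9/16" using mult_mono[OF pos] pos by simp
  have "1 - s * t = (1 - s) * t + (1 - t)" by (simp add: algebra_simps)
  then have "\<bar>1 - s * t\<bar> \<le> \<bar>1 - s\<bar> * \<bar>t\<bar> + \<bar>1 - t\<bar>"
    by (metis abs_mult abs_triangle_ineq)
  also have "\<dots> \<le> \<eta> * (5/4) + \<eta>"
    using assms pos \<open>t \<le> 5/4\<close> by (intro add_mono mult_mono) auto
  \<comment> \<open>Written with the factor 9/16, the lower bound for \<open>s * t\<close>, so that
    division by \<open>s * t\<close> leaves \<open>4 * \<eta>\<close>.\<close>
  also have "\<dots> = 4 * \<eta> * (9/16)" by simp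
  also have "\<dots> \<le> 4 * \<eta> * (s * t)"
    using st assms(1) by (intro mult_left_mono) auto
  finally have "\<bar>1 - s * t\<bar> / (s * t) \<le> 4 * \<eta>"
    using st by (simp add: divide_le_eq)
  moreover have "1 / s * (1 / t) - 1 = (1 - s * t) / (s * t)"
    using pos by (simp add: field_simps)
  ultimately show ?thesis using st by simp
qed

text \<open>The form takes the value \<open>c *\<^sub>R (P o\<^sub>L A)\<close> with
  \<open>c\<close> close to 1. Normalisation contributes an error of at most
  \<open>\<epsilon> / 4\<close>, the projection at most \<open>\<epsilon> / 2\<close>.\<close>

lemma double_shift_dense_values:
  fixes e :: "'i \<Rightarrow> 'h::complex_hilbert_space" and x y :: "'h op_seq"
  assumes e: "orthonormal_basis e"
    and x: "x \<in> mod_sphere" and y: "y \<in> mod_sphere" and A: "A \<in> compact_operators"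
    and "r > 0" "\<epsilon> > 0"
  shows "\<exists>n\<ge>1. \<exists>x'\<in>mod_sphere. \<exists>y'\<in>mod_sphere.
    mod_norm (\<lambda>j. x' j - x j) < r \<and> mod_norm (\<lambda>j. y' j - y j) < r \<and>
    mod_form ((double_shift ^^ n) x') y' \<in> compact_operators \<and>
    norm (mod_form ((double_shift ^^ n) x') y' - A) < \<epsilon>"
proof -
  \<comment> \<open>The bound \<open>q\<close> makes
    \<open>4 * \<eta> * (norm A + \<epsilon>)\<close> at most \<open>\<epsilon> / 4\<close>. In
    \<open>\<eta>\<close>, the bound \<open>r / 3\<close> yields \<open>2 * \<eta> < r\<close>, and
    \<open>1/4\<close> serves \<open>inverse_product_near_one\<close>.\<close>
  define q where "q = \<epsilon> / (16 * (norm A + \<epsilon>))"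
  define \<eta> where "\<eta> = min (1/4) (min (r / 3) q)"
  have "q > 0" using \<open>\<epsilon> > 0\<close> by (simp add: q_def add_nonneg_pos)
  then have \<eta>: "0 < \<eta>" "\<eta> \<le> 1/4" "\<eta> \<le> r / 3" "\<eta> \<le> q"
    using \<open>r > 0\<close> unfolding \<eta>_def by linarith+
  obtain F where F: "finite F" "norm ((projection e F o\<^sub>L A) - A) \<le> \<epsilon> / 2"
    using compact_operator_approx[OF e A, of "\<epsilon> / 2"] \<open>\<epsilon> > 0\<close> by auto
  define P where "P = projection e F"
  have P: "P \<in> compact_operators" "op_adjoint P = P" and lin: "complex_linear P"
    by (simp_all add: P_def projection_compact op_adjoint_projection compact_operators_complex_linear)
  have "norm P \<le> 1"
    unfolding P_def by (rule norm_blinfun_bound) (simp_all add: norm_projection_le[OF e F(1)])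
  have "\<eta> < 1" using \<eta> by simp
  obtain M1 where M1: "\<And>m k a. m \<ge> M1 \<Longrightarrow> k \<ge> m \<Longrightarrow> a \<in> compact_operators \<Longrightarrow> norm a \<le> \<eta> / 2 \<Longrightarrow>
      (\<exists>s. \<bar>s - 1\<bar> \<le> \<eta> \<and> (\<lambda>j. (1/s) *\<^sub>R truncate_insert m k a x j) \<in> mod_sphere \<and>
      mod_norm (\<lambda>j. (1/s) *\<^sub>R truncate_insert m k a x j - x j) \<le> 2 * \<eta>)"
    using sphere_perturbation[OF x \<eta>(1) \<open>\<eta> < 1\<close>] by blast
  obtain M2 where M2: "\<And>m k a. m \<ge> M2 \<Longrightarrow> k \<ge> m \<Longrightarrow> a \<in> compact_operators \<Longrightarrow> norm a \<le> \<eta> / 2 \<Longrightarrow>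
      (\<exists>s. \<bar>s - 1\<bar> \<le> \<eta> \<and> (\<lambda>j. (1/s) *\<^sub>R truncate_insert m k a y j) \<in> mod_sphere \<and>
      mod_norm (\<lambda>j. (1/s) *\<^sub>R truncate_insert m k a y j - y j) \<le> 2 * \<eta>)"
    using sphere_perturbation[OF y \<eta>(1) \<open>\<eta> < 1\<close>] by blast
  define m where "m = max M1 M2"
  define \<delta> where "\<delta> = \<eta> / 2"
  have "\<delta> > 0" using \<eta> by (simp add: \<delta>_def)
  \<comment> \<open>The growth of the powers of 2 is used here: it brings the norm of
    \<open>a\<close> below \<open>\<delta>\<close>, however small \<open>\<delta>\<close>
    is.\<close>
  obtain n0 where n0: "norm A / \<delta>\<^sup>2 < 2 ^ n0"
    using real_arch_pow[of 2 "norm A / \<delta>\<^sup>2"] by auto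
  define n where "n = Suc (n0 + m)"
  have n: "n \<ge> 1" "m \<le> n" by (simp_all add: n_def)
  have "norm A < 2 ^ n0 * \<delta>\<^sup>2"
    using n0 \<open>\<delta> > 0\<close> by (simp add: divide_less_eq)
  also have "\<dots> \<le> 2 ^ n * \<delta>\<^sup>2"
    by (intro mult_right_mono power_increasing) (simp_all add: n_def)
  finally have pow: "norm A \<le> \<delta> * (\<delta> * 2 ^ n)"
    by (simp add: power2_eq_square mult_ac)
  define a where "a = (1 / (\<delta> * 2 ^ n)) *\<^sub>R A"
  have a: "a \<in> compact_operators" "norm a \<le> \<eta> / 2"
    using compact_operators_scaleR[OF A] pow \<open>\<delta> > 0\<close>
    by (simp_all add: a_def divide_le_eq flip: \<delta>_def)
  have b: "\<delta> *\<^sub>R P \<in> compact_operators" "norm (\<delta> *\<^sub>R P) \<le> \<eta> / 2"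
    using compact_operators_scaleR[OF P(1)] \<open>norm P \<le> 1\<close> \<open>\<delta> > 0\<close>
    by (simp_all add: mult_left_le flip: \<delta>_def)
  obtain s where s: "\<bar>s - 1\<bar> \<le> \<eta>" "(\<lambda>j. (1/s) *\<^sub>R truncate_insert m m a x j) \<in> mod_sphere"
    "mod_norm (\<lambda>j. (1/s) *\<^sub>R truncate_insert m m a x j - x j) \<le> 2 * \<eta>"
    using M1[OF _ _ a, of m m] by (auto simp: m_def)
  obtain t where t: "\<bar>t - 1\<bar> \<le> \<eta>" "(\<lambda>j. (1/t) *\<^sub>R truncate_insert m (n + m) (\<delta> *\<^sub>R P) y j) \<in> mod_sphere"
    "mod_norm (\<lambda>j. (1/t) *\<^sub>R truncate_insert m (n + m) (\<delta> *\<^sub>R P) y j - y j) \<le> 2 * \<eta>"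
    using M2[OF _ _ b, of m "n + m"] by (auto simp: m_def)
  let ?x = "\<lambda>j. (1/s) *\<^sub>R truncate_insert m m a x j"
  let ?y = "\<lambda>j. (1/t) *\<^sub>R truncate_insert m (n + m) (\<delta> *\<^sub>R P) y j"
  define c where "c = 1 / s * (1 / t)"
  have "mod_form ((double_shift ^^ n) ?x) ?y = (c * 2 ^ n) *\<^sub>R (op_adjoint (\<delta> *\<^sub>R P) o\<^sub>L a)"
    unfolding c_def
    by (rule mod_form_double_shift_truncate_insert[OF n(2) compact_operators_complex_linear[OF b(1)]])
  also have "op_adjoint (\<delta> *\<^sub>R P) = \<delta> *\<^sub>R P"
    by (simp add: op_adjoint_scaleR[OF lin] P(2))
  \<comment> \<open>The factors \<open>\<delta>\<close> and \<open>2 ^ n\<close> cancel against the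
    scaling of \<open>a\<close>, leaving only the normalising constant.\<close>
  also have "(c * 2 ^ n) *\<^sub>R (\<delta> *\<^sub>R P o\<^sub>L a) = c *\<^sub>R (P o\<^sub>L A)"
    using \<open>\<delta> > 0\<close> by (intro blinfun_eqI) (simp add: a_def blinfun.scaleR_left blinfun.scaleR_right)
  finally have form: "mod_form ((double_shift ^^ n) ?x) ?y = c *\<^sub>R (P o\<^sub>L A)" .
  have PA: "norm ((P o\<^sub>L A) - A) \<le> \<epsilon> / 2" using F(2) by (simp add: P_def)
  then have PA': "norm (P o\<^sub>L A) \<le> norm A + \<epsilon>"
    using norm_triangle_sub[of "P o\<^sub>L A" A] \<open>\<epsilon> > 0\<close> by linarith
  have "c *\<^sub>R (P o\<^sub>L A) - A = (c - 1) *\<^sub>R (P o\<^sub>L A) + ((P o\<^sub>L A) - A)"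
    by (simp add: algebra_simps)
  then have "norm (c *\<^sub>R (P o\<^sub>L A) - A) \<le> \<bar>c - 1\<bar> * norm (P o\<^sub>L A) + norm ((P o\<^sub>L A) - A)"
    by (metis norm_scaleR norm_triangle_ineq)
  also have "\<bar>c - 1\<bar> * norm (P o\<^sub>L A) \<le> 4 * \<eta> * (norm A + \<epsilon>)"
    using inverse_product_near_one[OF s(1) t(1) \<eta>(2)] PA' \<eta>(1)
    by (intro mult_mono) (auto simp: c_def)
  also have "\<dots> \<le> \<epsilon> / 4"
    using \<eta>(4) \<open>\<epsilon> > 0\<close> by (simp add: q_def le_divide_eq add_nonneg_pos mult_ac)
  finally have "norm (c *\<^sub>R (P o\<^sub>L A) - A) < \<epsilon>" using PA \<open>\<epsilon> > 0\<close> by linarith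
  moreover have "c *\<^sub>R (P o\<^sub>L A) \<in> compact_operators"
    by (intro compact_operators_scaleR compact_operators_compose A lin)
  moreover have "2 * \<eta> < r" using \<eta> \<open>r > 0\<close> by linarith
  ultimately show ?thesis
    using n(1) s(2,3) t(2,3) form
    by (intro exI[of _ n] conjI bexI[of _ ?x] bexI[of _ ?y]) auto
qed

theorem proposition4p7:
  fixes e :: "int \<Rightarrow> 'h::complex_hilbert_space"
  assumes "orthonormal_basis e"
  shows "\<exists>T :: 'h op_seq \<Rightarrow> 'h op_seq. bounded_operator T \<and>
           topologically_Cstar_transitive T \<and> \<not> generalized_numerically_transitive T"
proof (intro exI[of _ double_shift] conjI bounded_operator_double_shift)
  show "topologically_Cstar_transitive (double_shift :: 'h op_seq \<Rightarrow> 'h op_seq)"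
    unfolding topologically_Cstar_transitive_def
  proof (intro allI impI, elim conjE)
    fix W :: "('h op_seq \<times> 'h op_seq) set" and V :: "('h \<Rightarrow>\<^sub>L 'h) set"
    assume W: "openin (subtopology (prod_topology mod_topology mod_topology)
        (mod_sphere \<times> mod_sphere)) W" "W \<noteq> {}"
      and V: "openin (top_of_set compact_operators) V" "V \<noteq> {}"
    \<comment> \<open>\<open>V\<close> is only relatively open, so the values of the form must be
      shown to be compact as well as close to \<open>A\<close>.\<close>
    obtain A \<epsilon> where A: "A \<in> compact_operators" "\<epsilon> > 0"
      and V_ball: "ball A \<epsilon> \<inter> compact_operators \<subseteq> V"
      using V unfolding openin_contains_ball by blast
    obtain U where U: "openin (prod_topology mod_topology mod_topology) U"
      and WU: "W = U \<inter> (mod_sphere \<times> mod_sphere)"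
      using W(1) unfolding openin_subtopology by blast
    obtain x y where xy: "(x, y) \<in> U" "x \<in> mod_sphere" "y \<in> mod_sphere"
      using W(2) WU by auto
    obtain U1 U2 where U1: "openin mod_topology U1" "x \<in> U1"
      and U2: "openin mod_topology U2" "y \<in> U2" and sub: "U1 \<times> U2 \<subseteq> U"
      using U xy(1) unfolding openin_prod_topology_alt by blast
    obtain r1 where r1: "r1 > 0" "\<And>z. z \<in> std_module \<Longrightarrow> mod_norm (\<lambda>j. z j - x j) < r1 \<Longrightarrow> z \<in> U1"
      using U1 unfolding openin_mod_topology by blast
    obtain r2 where r2: "r2 > 0" "\<And>z. z \<in> std_module \<Longrightarrow> mod_norm (\<lambda>j. z j - y j) < r2 \<Longrightarrow> z \<in> U2"
      using U2 unfolding openin_mod_topology by blast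
    obtain n x' y' where n: "n \<ge> 1" and x': "x' \<in> mod_sphere" "mod_norm (\<lambda>j. x' j - x j) < min r1 r2"
      and y': "y' \<in> mod_sphere" "mod_norm (\<lambda>j. y' j - y j) < min r1 r2"
      and form: "mod_form ((double_shift ^^ n) x') y' \<in> compact_operators"
        "norm (mod_form ((double_shift ^^ n) x') y' - A) < \<epsilon>"
      using double_shift_dense_values[OF assms xy(2,3) A(1) _ A(2), of "min r1 r2"] r1(1) r2(1)
      by auto
    have "(x', y') \<in> W"
      using r1(2)[of x'] r2(2)[of y'] x' y' sub by (auto simp: WU mod_sphere_def)
    moreover have "mod_form ((double_shift ^^ n) x') y' \<in> V"
      using form V_ball by (auto simp: dist_norm norm_minus_commute)
    ultimately show "\<exists>n\<ge>1. \<exists>(x, y)\<in>W. mod_form ((double_shift ^^ n) x) y \<in> V"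
      using n by blast
  qed
  show "\<not> generalized_numerically_transitive (double_shift :: 'h op_seq \<Rightarrow> 'h op_seq)"
  proof
    assume trans: "generalized_numerically_transitive (double_shift :: 'h op_seq \<Rightarrow> 'h op_seq)"
    \<comment> \<open>For \<open>n \<ge> 1\<close> the first entry of the \<open>n\<close>-th
      iterate is 0, so no componentwise product with it lies in this set.\<close>
    define V where "V = {z :: 'h op_seq. z \<in> std_module \<and> z 0 \<noteq> 0}"
    have univ: "openin mod_topology (std_module :: 'h op_seq set)"
      unfolding openin_mod_topology by (auto intro: exI[of _ 1])
    have "openin mod_topology V"
      unfolding openin_mod_topology
    proof (intro conjI ballI)
      fix x assume x: "x \<in> V"
      show "\<exists>r>0. \<forall>y\<in>std_module. mod_norm (\<lambda>j. y j - x j) < r \<longrightarrow> y \<in> V"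
      \<comment> \<open>A change of the first entry by less than its norm cannot make it
        vanish.\<close>
      proof (intro exI[of _ "norm (x 0)"] conjI ballI impI)
        fix y assume y: "y \<in> std_module" "mod_norm (\<lambda>j. y j - x j) < norm (x 0)"
        have "norm (y 0 - x 0) \<le> mod_norm (\<lambda>j. y j - x j)"
          using norm_component_le_mod_norm[OF std_module_diff, of y x 0] x y(1)
          by (simp add: V_def)
        with y show "y \<in> V" by (auto simp: V_def)
      qed (use x in \<open>simp add: V_def\<close>)
    qed (auto simp: V_def)
    moreover have "(\<lambda>j. if j = 0 then projection e {0} else 0) \<in> V"
      using std_module_single[OF projection_compact, of 0 e "{0}"] projection_nonzero[OF assms, of 0]
      by (simp add: V_def)
    \<comment> \<open>All pairs may be allowed, since the obstruction holds for every
      \<open>x\<close> and \<open>y\<close>.\<close>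
    moreover have "openin (prod_topology mod_topology mod_topology)
        ((std_module :: 'h op_seq set) \<times> (std_module :: 'h op_seq set))"
      using univ by (simp add: openin_prod_Times_iff)
    moreover have "(\<lambda>j. 0 :: 'h \<Rightarrow>\<^sub>L 'h) \<in> std_module" by (rule std_module_zero)
    ultimately obtain n x y where "n \<ge> 1" "(\<lambda>j. x j o\<^sub>L (double_shift ^^ n) y j) \<in> V"
      using trans unfolding generalized_numerically_transitive_def by blast
    then show False by (simp add: V_def double_shift_funpow)
  qed
qed

end
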